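(* Let $n,k\ge 1$ and let $H=[H_{ij}]_{i,j=1}^n\in \mathbb{M}_n(\mathbb{M}_k)$ be positive semidefinite. Then for every positive integer $r$, $$\det\bigl[(\det H_{ij})^r\bigr]_{i,j=1}^n\ \ge\ (\det H)^r .$$
   Context: $\mathbb{M}_k$ denotes the set of $k\times k$ complex matrices. $\mathbb{M}_n(\mathbb{M}_k)$ denotes the set of complex $nk\times nk$ matrices partitioned into $n\times n$ blocks, each block $H_{ij}$ being a $k\times k$ matrix. "Positive semidefinite" refers to $H$ as an $nk\times nk$ complex (Hermitian) matrix. $[(\det H_{ij})^r]_{i,j=1}^n$ is the $n\times n$ complex matrix whose $(i,j)$ entry is the $r$-th power of the determinant of the block $H_{ij}$. *)

theory Defs
  imports "Jordan_Normal_Form.Schur_Decomposition"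
begin

text \<open>
  Since \<^term>\<open>(A *\<^sub>v x) \<bullet>c x\<close> is the quadratic form of \<^term>\<open>A\<close> at \<^term>\<open>x\<close> and the order
  on \<^typ>\<open>complex\<close> is that of \<^theory>\<open>HOL-Library.Complex_Order\<close>, the last conjunct says that
  the quadratic form is real and nonnegative.
\<close>

definition positive_semidefinite :: "complex mat \<Rightarrow> bool" where
  "positive_semidefinite A \<longleftrightarrow>
     square_mat A \<and> mat_adjoint A = A \<and>
     (\<forall>x \<in> carrier_vec (dim_row A). 0 \<le> (A *\<^sub>v x) \<bullet>c x)"

text \<open>
  Block indices \<^term>\<open>i\<close>, \<^term>\<open>j\<close> start at 0, as do the entries of \<^typ>\<open>'a mat\<close>. If \<^term>\<open>H\<close>
  has dimension \<open>n * k\<close>, its blocks are those with \<open>i < n\<close> and \<open>j < n\<close>.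
\<close>

definition block :: "nat \<Rightarrow> 'a mat \<Rightarrow> nat \<Rightarrow> nat \<Rightarrow> 'a mat" where
  "block k H i j = mat k k (\<lambda>(a, b). H $$ (i * k + a, j * k + b))"

end

theory Submission
  imports Defs
begin

text \<open>
  Write \<open>H = T\<^sup>* T\<close> with \<open>T\<close> lower triangular. By the Cauchy--Binet formula,
  \<open>det H\<^sub>i\<^sub>j\<close> is the sum of \<open>cnj (D S i) * D S j\<close> over all sets \<open>S\<close> of \<open>k\<close> row indices, where
  \<open>D S i\<close> is the minor of \<open>T\<close> with rows \<open>S\<close> and the columns of the \<open>i\<close>-th block. Expanding the
  \<open>r\<close>-th power over \<open>r\<close>-tuples of such sets exhibits \<open>[(det H\<^sub>i\<^sub>j)^r]\<close> as a Gram matrix \<open>V\<^sup>* V\<close>.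
  By Cauchy--Binet again its determinant is a sum of squared moduli of minors of \<open>V\<close>, hence at
  least the term whose \<open>l\<close>-th row is the constant tuple of the \<open>l\<close>-th interval of row indices. That
  minor is lower triangular with diagonal entries \<open>(det T\<^sub>l\<^sub>l)^r\<close>, so its squared modulus is
  \<open>(det H)^r\<close>.
\<close>

section \<open>The Cauchy--Binet formula\<close>

text \<open>Multilinearity in the rows gives a sum over all maps from positions to \<open>M\<close>.
  A non-injective map yields a determinant with two equal rows; an injective one is a fixed
  enumeration of its image composed with a permutation. The enumeration \<open>h\<close> stays
  arbitrary, since reordering a set changes both of its minors by the same sign; this freedom is
  used later.\<close>

lemma Cauchy_Binet:
  fixes x y :: "'s \<Rightarrow> nat \<Rightarrow> 'a :: comm_ring_1" and h :: "'s set \<Rightarrow> nat \<Rightarrow> 's"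
  assumes M: "finite M"
    and h: "\<And>S. S \<subseteq> M \<Longrightarrow> card S = k \<Longrightarrow> bij_betw (h S) {0..<k} S"
  shows "det (mat k k (\<lambda>(a, b). \<Sum>s\<in>M. x s a * y s b)) =
    (\<Sum>S | S \<subseteq> M \<and> card S = k.
      det (mat k k (\<lambda>(p, a). x (h S p) a)) * det (mat k k (\<lambda>(p, b). y (h S p) b)))"
proof -
  let ?P = "{p. p permutes {0..<k}}" and ?F = "{0..<k} \<rightarrow>\<^sub>E M"
  let ?K = "{S. S \<subseteq> M \<and> card S = k}"
  let ?Y = "\<lambda>f. mat k k (\<lambda>(a, b). y (f a) b)"
  let ?t = "\<lambda>f. (\<Prod>a=0..<k. x (f a) a) * det (?Y f)"
  have permutes_less: "p a < k \<longleftrightarrow> a < k" if "p permutes {0..<k}" for p a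
    using permutes_in_image[OF that, of a] by simp
  have finF: "finite ?F" using M by (simp add: finite_PiE)
  have "det (mat k k (\<lambda>(a, b). \<Sum>s\<in>M. x s a * y s b)) =
      (\<Sum>p\<in>?P. signof p * (\<Prod>a=0..<k. \<Sum>s\<in>M. x s a * y s (p a)))"
    by (subst det_def'[of _ k]) (auto intro!: sum.cong prod.cong simp: permutes_less)
  also have "\<dots> = (\<Sum>p\<in>?P. signof p * (\<Sum>f\<in>?F. \<Prod>a=0..<k. x (f a) a * y (f a) (p a)))"
    using M by (intro sum.cong refl arg_cong2[where f = "(*)"] prod_sum_PiE) auto
  also have "\<dots> = (\<Sum>f\<in>?F. \<Sum>p\<in>?P. signof p * (\<Prod>a=0..<k. x (f a) a * y (f a) (p a)))"
    unfolding sum_distrib_left by (rule sum.swap)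
  also have "\<dots> = (\<Sum>f\<in>?F. ?t f)"
  proof (rule sum.cong[OF refl])
    fix f
    show "(\<Sum>p\<in>?P. signof p * (\<Prod>a=0..<k. x (f a) a * y (f a) (p a))) = ?t f"
      by (subst det_def'[of _ k])
        (auto intro!: sum.cong prod.cong simp: permutes_less prod.distrib sum_distrib_left mult_ac)
  qed
  also have "\<dots> = (\<Sum>f\<in>{f \<in> ?F. inj_on f {0..<k}}. ?t f)"
  proof (rule sum.mono_neutral_right[OF finF])
    show "\<forall>f\<in>?F - {f \<in> ?F. inj_on f {0..<k}}. ?t f = 0"
    proof
      fix f assume "f \<in> ?F - {f \<in> ?F. inj_on f {0..<k}}"
      then obtain i j where ij: "i < k" "j < k" "i \<noteq> j" "f i = f j"
        by (auto simp: inj_on_def)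
      have "det (?Y f) = 0"
        by (rule det_identical_rows[OF _ ij(3,1,2)]) (use ij in auto)
      then show "?t f = 0" by simp
    qed
  qed auto
  also have "\<dots> = (\<Sum>(S, p)\<in>?K \<times> ?P. ?t (h S \<circ> p))"
  \<comment> \<open>A map corresponds to its image together with a permutation of positions relative
    to \<open>h\<close>. Outside \<open>{0..<k}\<close> the permutation must be the identity and the
    map \<open>undefined\<close>, hence the case distinction and \<open>restrict\<close>.\<close>
  proof (rule sum.reindex_bij_witness[where
        i = "\<lambda>(S, p). restrict (h S \<circ> p) {0..<k}" and
        j = "\<lambda>f. (f ` {0..<k}, \<lambda>a. if a \<in> {0..<k} then inv_into {0..<k} (h (f ` {0..<k})) (f a) else a)"])
    fix f assume f: "f \<in> {f \<in> ?F. inj_on f {0..<k}}"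
    let ?S = "f ` {0..<k}"
    let ?p = "\<lambda>a. if a \<in> {0..<k} then inv_into {0..<k} (h ?S) (f a) else a"
    have S: "?S \<in> ?K" using f by (auto simp: card_image)
    then have bij: "bij_betw (h ?S) {0..<k} ?S" using h by auto
    have "bij_betw (inv_into {0..<k} (h ?S) \<circ> f) {0..<k} {0..<k}"
      using f bij_betw_inv_into[OF bij] by (intro bij_betw_trans[of f _ ?S]) (auto simp: bij_betw_def)
    then have "bij_betw ?p {0..<k} {0..<k}"
      by (subst bij_betw_cong[of _ _ "inv_into {0..<k} (h ?S) \<circ> f"]) auto
    then have p: "?p permutes {0..<k}" by (rule bij_imp_permutes) auto
    show "(case (?S, ?p) of (S, p) \<Rightarrow> restrict (h S \<circ> p) {0..<k}) = f"
      using f bij by (auto simp: fun_eq_iff bij_betw_inv_into_right PiE_def extensional_def)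
    show "(?S, ?p) \<in> ?K \<times> ?P" using S p by auto
    have e: "(h ?S \<circ> ?p) a = f a" if "a \<in> {0..<k}" for a
      using that bij by (auto simp: bij_betw_inv_into_right)
    have "?Y (h ?S \<circ> ?p) = ?Y f" by (rule cong_mat) (use e in auto)
    then show "(case (?S, ?p) of (S, p) \<Rightarrow> ?t (h S \<circ> p)) = ?t f"
      using prod.cong[OF refl, of "{0..<k}" "\<lambda>a. x ((h ?S \<circ> ?p) a) a" "\<lambda>a. x (f a) a"] e by simp
  next
    fix Sp assume "Sp \<in> ?K \<times> ?P"
    then obtain S p where Sp: "Sp = (S, p)" "S \<in> ?K" "p permutes {0..<k}" by auto
    have bij: "bij_betw (h S) {0..<k} S" using h Sp by auto
    have hp: "bij_betw (h S \<circ> p) {0..<k} S"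
      using permutes_imp_bij[OF Sp(3)] bij by (rule bij_betw_trans)
    let ?f = "restrict (h S \<circ> p) {0..<k}"
    have f: "bij_betw ?f {0..<k} S"
      using hp by (subst bij_betw_cong[of _ _ "h S \<circ> p"]) auto
    have im: "?f ` {0..<k} = S" using f by (auto simp: bij_betw_def)
    have inv: "inv_into {0..<k} (h S) (h S (p a)) = p a" if "a < k" for a
      using bij that Sp(3) by (auto intro!: bij_betw_inv_into_left simp: permutes_less)
    have pp: "p a = a" if "\<not> a < k" for a
      using Sp(3) that by (auto simp: permutes_def)
    have "(case Sp of (S, p) \<Rightarrow> restrict (h S \<circ> p) {0..<k}) = ?f" using Sp by simp
    then show "(\<lambda>f. (f ` {0..<k}, \<lambda>a. if a \<in> {0..<k} then inv_into {0..<k} (h (f ` {0..<k})) (f a) else a))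
        (case Sp of (S, p) \<Rightarrow> restrict (h S \<circ> p) {0..<k}) = Sp"
      using Sp inv pp by (simp only: im) (auto simp: fun_eq_iff)
    show "(case Sp of (S, p) \<Rightarrow> restrict (h S \<circ> p) {0..<k}) \<in> {f \<in> ?F. inj_on f {0..<k}}"
      using f Sp by (auto simp: bij_betw_def)
  qed
  also have "\<dots> = (\<Sum>S\<in>?K. \<Sum>p\<in>?P. ?t (h S \<circ> p))"
    by (simp add: sum.cartesian_product)
  also have "\<dots> = (\<Sum>S\<in>?K.
      det (mat k k (\<lambda>(p, a). x (h S p) a)) * det (mat k k (\<lambda>(p, b). y (h S p) b)))"
  proof (rule sum.cong[OF refl])
    fix S
    have Y: "det (?Y (h S \<circ> p)) = signof p * det (?Y (h S))" if "p \<in> ?P" for p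
    proof -
      have "?Y (h S \<circ> p) = mat k k (\<lambda>(i, j). ?Y (h S) $$ (p i, j))"
        using that by (auto simp: permutes_less)
      then show ?thesis using det_permute_rows[of "?Y (h S)" k p] that by simp
    qed
    have "(\<Sum>p\<in>?P. ?t (h S \<circ> p)) =
        (\<Sum>p\<in>?P. signof p * (\<Prod>a=0..<k. x (h S (p a)) a)) * det (?Y (h S))"
      unfolding sum_distrib_right by (rule sum.cong[OF refl]) (simp add: Y[unfolded comp_def] mult_ac)
    \<comment> \<open>The permutation now acts on the row index, so this is the column form of the
      Leibniz formula.\<close>
    also have "(\<Sum>p\<in>?P. signof p * (\<Prod>a=0..<k. x (h S (p a)) a)) = det (mat k k (\<lambda>(p, a). x (h S p) a))"
      by (subst det_col[of _ k])
        (auto intro!: sum.cong prod.cong simp: permutes_less lessThan_atLeast0)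
    finally show "(\<Sum>p\<in>?P. ?t (h S \<circ> p)) =
        det (mat k k (\<lambda>(p, a). x (h S p) a)) * det (mat k k (\<lambda>(p, b). y (h S p) b))" .
  qed
  finally show ?thesis .
qed

lemma det_cnj:
  "det (mat k k (\<lambda>(a, b). cnj (f a b))) = cnj (det (mat k k (\<lambda>(a, b). f a b)))"
proof -
  interpret comm_ring_hom cnj by unfold_locales auto
  show ?thesis
    unfolding hom_det[symmetric] by (rule arg_cong[where f = det]) auto
qed

lemma Cauchy_Binet_cnj:
  fixes x :: "'s \<Rightarrow> nat \<Rightarrow> complex"
  assumes "finite M" and "\<And>S. S \<subseteq> M \<Longrightarrow> card S = k \<Longrightarrow> bij_betw (h S) {0..<k} S"
  shows "det (mat k k (\<lambda>(a, b). \<Sum>s\<in>M. cnj (x s a) * y s b)) =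
    (\<Sum>S | S \<subseteq> M \<and> card S = k.
      cnj (det (mat k k (\<lambda>(p, a). x (h S p) a))) * det (mat k k (\<lambda>(p, b). y (h S p) b)))"
  using Cauchy_Binet[OF assms, of "\<lambda>s a. cnj (x s a)" y] by (simp add: det_cnj)

section \<open>Gram determinants\<close>

lemma det_gram_ge:
  fixes v :: "'s \<Rightarrow> nat \<Rightarrow> complex"
  assumes I: "finite I" and s: "inj_on s {0..<n}" "s ` {0..<n} \<subseteq> I"
  shows "det (mat n n (\<lambda>(i, j). \<Sum>t\<in>I. cnj (v t i) * v t j)) \<ge>
    cnj (det (mat n n (\<lambda>(l, i). v (s l) i))) * det (mat n n (\<lambda>(l, i). v (s l) i))"
proof -
  let ?S = "s ` {0..<n}"
  \<comment> \<open>On the image of \<open>s\<close> the enumeration is \<open>s\<close> itself, so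
    that the minor of this set is literally the one in the claim.\<close>
  define h where "h S = (if S = ?S then s else SOME g. bij_betw g {0..<n} S)" for S
  have h: "bij_betw (h S) {0..<n} S" if "S \<subseteq> I" "card S = n" for S
  proof (cases "S = ?S")
    case True
    then show ?thesis using s by (auto simp: h_def bij_betw_def)
  next
    case False
    have "\<exists>g. bij_betw g {0..<n} S"
      using that I ex_bij_betw_nat_finite[of S] finite_subset by auto
    then have "bij_betw (SOME g. bij_betw g {0..<n} S) {0..<n} S" by (rule someI_ex)
    then show ?thesis using False by (simp only: h_def if_False)
  qed
  let ?d = "\<lambda>S. det (mat n n (\<lambda>(l, i). v (h S l) i))"
  have "cnj (?d ?S) * ?d ?S \<le> (\<Sum>S | S \<subseteq> I \<and> card S = n. cnj (?d S) * ?d S)"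
    by (rule member_le_sum) (use s I in \<open>auto simp: card_image mult.commute[of "cnj _"] complex_mult_cnj less_eq_complex_def\<close>)
  then show ?thesis
    using Cauchy_Binet_cnj[where x = v and y = v and h = h and k = n, OF I h] by (simp add: h_def)
qed

section \<open>Cholesky factorization of semidefinite matrices\<close>

text \<open>Induction on the size: removing the contribution of the last row of \<open>T\<close>
  leaves a smaller semidefinite form. Eliminating from the end, not from the start, makes
  \<open>T\<close> lower triangular in \<open>T\<^sup>* T\<close>.\<close>

lemma cholesky_lower:
  fixes A :: "nat \<Rightarrow> nat \<Rightarrow> complex"
  assumes "\<And>i j. i < m \<Longrightarrow> j < m \<Longrightarrow> A j i = cnj (A i j)"
    and "\<And>x. 0 \<le> (\<Sum>i<m. \<Sum>j<m. cnj (x i) * A i j * x j)"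
  shows "\<exists>T. (\<forall>i<m. \<forall>j<m. A i j = (\<Sum>l<m. cnj (T l i) * T l j)) \<and> (\<forall>l i. l < i \<longrightarrow> T l i = 0)"
  using assms
proof (induction m arbitrary: A)
  case 0
  then show ?case by (auto intro: exI[of _ "\<lambda>_ _. 0"])
next
  case (Suc m)
  define a where "a = A m m"
  define q where "q x = (\<Sum>i<m. \<Sum>j<m. cnj (x i) * A i j * x j)" for x
  define s where "s x = (\<Sum>j<m. A m j * x j)" for x
  have herm: "A i m = cnj (A m i)" if "i < m" for i
    using Suc.prems(1)[of m i] that by simp
  \<comment> \<open>The form at \<open>x\<close> extended by a last coordinate \<open>y\<close>.
    Each positivity fact below is a choice of \<open>y\<close>.\<close>
  have split: "0 \<le> q x + cnj (s x) * y + cnj y * s x + cnj y * a * y" for x y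
  proof -
    have "(\<Sum>i<Suc m. \<Sum>j<Suc m. cnj ((x(m := y)) i) * A i j * (x(m := y)) j)
      = q x + cnj (s x) * y + cnj y * s x + cnj y * a * y"
      by (simp add: q_def s_def a_def sum.distrib sum_distrib_left sum_distrib_right herm mult_ac)
    then show ?thesis using Suc.prems(2)[of "x(m := y)"] by simp
  qed
  have a0: "0 \<le> a" using split[of "\<lambda>_. 0" 1] by (simp add: q_def s_def)
  then obtain c where c: "a = complex_of_real c" "c \<ge> 0"
    by (intro that[of "Re a"]) (auto simp: less_eq_complex_def complex_eq_iff)
  \<comment> \<open>With a zero pivot the form is affine along \<open>y = - t * s x\<close>, so a
    nonzero slope would make it negative.\<close>
  have s0: "s x = 0" if "c = 0" for x
  proof (rule ccontr)
    assume ne: "s x \<noteq> 0"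
    define u where "u = (cmod (s x))\<^sup>2"
    have u: "cnj (s x) * s x = complex_of_real u" "u > 0"
      using ne unfolding u_def by (auto simp: complex_norm_square mult.commute simp del: of_real_power)
    have "0 \<le> Re (q x) - 2 * t * u" for t
    proof -
      have "0 \<le> q x - 2 * complex_of_real t * (cnj (s x) * s x)"
        using split[of x "- complex_of_real t * s x"] that c by (simp add: algebra_simps)
      then show ?thesis unfolding u by (simp add: less_eq_complex_def)
    qed
    \<comment> \<open>For this \<open>t\<close> the right-hand side is -1.\<close>
    from this[of "(Re (q x) + 1) / (2 * u)"] u show False by (simp add: field_simps)
  qed
  have Am0: "A m i = 0" if "c = 0" "i < m" for i
  proof -
    have "s (\<lambda>j. if j = i then 1 else 0) = A m i"
      using that by (simp add: s_def if_distrib[of "\<lambda>z. _ * z"] cong: if_cong)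
    then show ?thesis using s0 that by metis
  qed
  \<comment> \<open>The Schur complement of \<open>a\<close>; for \<open>a = 0\<close> division by zero turns it into \<open>A\<close> itself.\<close>
  define B where "B i j = A i j - cnj (A m i) * A m j / a" for i j
  have "\<exists>T. (\<forall>i<m. \<forall>j<m. B i j = (\<Sum>l<m. cnj (T l i) * T l j)) \<and> (\<forall>l i. l < i \<longrightarrow> T l i = 0)"
  proof (rule Suc.IH)
    fix i j assume "i < m" "j < m"
    then show "B j i = cnj (B i j)" using Suc.prems(1)[of i j] c by (simp add: B_def)
  next
    fix x
    have "(\<Sum>i<m. \<Sum>j<m. cnj (x i) * B i j * x j) = q x - cnj (s x) * s x / a"
    proof -
      have "cnj (s x) * s x / a = (\<Sum>i<m. \<Sum>j<m. cnj (x i) * (cnj (A m i) * A m j / a) * x j)"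
        unfolding s_def cnj_sum sum_product sum_divide_distrib
        by (intro sum.cong refl) (simp add: mult_ac)
      then show ?thesis
        by (simp add: B_def q_def algebra_simps sum_subtractf)
    qed
    also have "\<dots> \<ge> 0"
    proof (cases "c = 0")
      case True
      then show ?thesis using split[of x 0] by (simp add: s0)
    next
      case False
      \<comment> \<open>The value \<open>y = - s x / a\<close> minimises the form over the last
        coordinate.\<close>
      then have "q x - cnj (s x) * s x / a =
          q x + cnj (s x) * (- s x / a) + cnj (- s x / a) * s x + cnj (- s x / a) * a * (- s x / a)"
        using c by simp
      then show ?thesis using split[of x "- s x / a"] by simp
    qed
    finally show "0 \<le> (\<Sum>i<m. \<Sum>j<m. cnj (x i) * B i j * x j)" .
  qed
  then obtain T where T: "\<And>i j. i < m \<Longrightarrow> j < m \<Longrightarrow> B i j = (\<Sum>l<m. cnj (T l i) * T l j)"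
      "\<And>l i. l < i \<Longrightarrow> T l i = 0" by blast
  let ?r = "complex_of_real (sqrt c)"
  have r: "?r * ?r = a" using c by (simp flip: of_real_mult)
  \<comment> \<open>The new row contributes exactly the term subtracted in \<open>B\<close>. For
    \<open>c = 0\<close> it is zero, in accordance with \<open>Am0\<close>.\<close>
  define U where "U l i = (if l < m then T l i else if l = m \<and> i < m then A m i / ?r
      else if l = m \<and> i = m then ?r else 0)" for l i
  have "A i j = (\<Sum>l<Suc m. cnj (U l i) * U l j)" if ij: "i < Suc m" "j < Suc m" for i j
  proof -
    have *: "(\<Sum>l<m. cnj (U l i) * U l j) = (\<Sum>l<m. cnj (T l i) * T l j)"
      by (simp add: U_def)
    consider "i < m" "j < m" | "i = m" "j < m" | "i < m" "j = m" | "i = m" "j = m"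
      using ij by linarith
    then show ?thesis
    proof cases
      case 1
      then have "A i j = B i j + cnj (A m i) * A m j / (?r * ?r)" by (simp add: B_def r)
      then show ?thesis using 1 T(1)[of i j] by (simp add: * U_def)
    next
      case 2
      then show ?thesis using Am0[of j] T(2) by (cases "c = 0") (auto simp: * U_def)
    next
      case 3
      then show ?thesis using Am0[of i] T(2) herm[of i] by (cases "c = 0") (auto simp: * U_def)
    next
      case 4
      then show ?thesis using T(2) r by (simp add: * U_def a_def)
    qed
  qed
  moreover have "U l i = 0" if "l < i" for l i
    using that T(2) by (auto simp: U_def)
  ultimately show ?case by blast
qed

lemma det_lower:
  assumes "\<And>l i. l < i \<Longrightarrow> i < n \<Longrightarrow> f l i = 0"
  shows "det (mat n n (\<lambda>(l, i). f l i)) = (\<Prod>i<n. f i i)"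
  by (subst det_lower_triangular[of n])
    (use assms in \<open>auto simp: prod_list_diag_prod lessThan_atLeast0 intro!: prod.cong\<close>)

lemma positive_semidefinite_cholesky:
  assumes H: "H \<in> carrier_mat m m" "positive_semidefinite H"
  obtains T where "\<And>i j. i < m \<Longrightarrow> j < m \<Longrightarrow> H $$ (i, j) = (\<Sum>l<m. cnj (T l i) * T l j)"
    and "\<And>l i. l < i \<Longrightarrow> T l i = 0"
proof -
  have adj: "mat_adjoint H = H"
    and pos: "\<And>x. x \<in> carrier_vec m \<Longrightarrow> 0 \<le> (H *\<^sub>v x) \<bullet>c x"
    using H by (auto simp: positive_semidefinite_def)
  have "H $$ (j, i) = cnj (H $$ (i, j))" if "i < m" "j < m" for i j
  proof -
    have "mat_adjoint H $$ (j, i) = cnj (H $$ (i, j))"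
      using that H(1) by (simp add: mat_adjoint_def mat_of_rows_def)
    then show ?thesis by (simp add: adj)
  qed
  moreover have "0 \<le> (\<Sum>i<m. \<Sum>j<m. cnj (x i) * H $$ (i, j) * x j)" for x
  proof -
    have "(H *\<^sub>v vec m x) \<bullet>c vec m x = (\<Sum>i<m. \<Sum>j<m. cnj (x i) * H $$ (i, j) * x j)"
      using H(1) by (simp add: scalar_prod_def lessThan_atLeast0 sum_distrib_left mult_ac)
    then show ?thesis using pos[of "vec m x"] by simp
  qed
  ultimately show ?thesis
    using cholesky_lower[of m "\<lambda>i j. H $$ (i, j)"] that by blast
qed

section \<open>The inequality for block determinants\<close>

theorem theorem4p1:
  fixes n k r :: nat and H :: "complex mat"
  assumes "n \<ge> 1" and "k \<ge> 1"
    and "H \<in> carrier_mat (n * k) (n * k)"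
    and "positive_semidefinite H"
    and "r \<ge> 1"
  shows "det (mat n n (\<lambda>(i, j). det (block k H i j) ^ r)) \<ge> det H ^ r"
proof -
  let ?m = "n * k"
  obtain T where HT: "\<And>i j. i < ?m \<Longrightarrow> j < ?m \<Longrightarrow> H $$ (i, j) = (\<Sum>l<?m. cnj (T l i) * T l j)"
    and low: "\<And>l i. l < i \<Longrightarrow> T l i = 0"
    using positive_semidefinite_cholesky[OF assms(3,4)] by blast
  \<comment> \<open>The increasing enumeration turns an interval of rows into a shift, so that
    \<open>D\<close> of a block interval is the determinant of a block of \<open>T\<close>.\<close>
  define h where "h S p = sorted_list_of_set S ! p" for S :: "nat set" and p
  define D where "D S i = det (mat k k (\<lambda>(p, a). T (h S p) (i * k + a)))" for S i
  let ?K = "{S. S \<subseteq> {..<?m} \<and> card S = k}"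
  have finK: "finite ?K" by simp
  have h: "bij_betw (h S) {0..<k} S" if "S \<subseteq> {..<?m}" "card S = k" for S
    using that bij_betw_nth[of "sorted_list_of_set S" "{..<k}" S] finite_subset[OF that(1)]
    by (simp add: h_def[abs_def] lessThan_atLeast0)
  have le: "i * k + a < ?m" if "i < n" "a < k" for i a
  proof -
    have "i * k + a < Suc i * k" using that by simp
    also have "\<dots> \<le> ?m" using that by (intro mult_le_mono1) simp
    finally show ?thesis .
  qed
  have block: "det (block k H i j) = (\<Sum>S\<in>?K. cnj (D S i) * D S j)" if "i < n" "j < n" for i j
  proof -
    have "block k H i j = mat k k (\<lambda>(a, b). \<Sum>s<?m. cnj (T s (i * k + a)) * T s (j * k + b))"
      unfolding block_def by (rule cong_mat) (use that le in \<open>auto simp: HT\<close>)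
    then show ?thesis
      using Cauchy_Binet_cnj[where x = "\<lambda>s a. T s (i * k + a)" and y = "\<lambda>s b. T s (j * k + b)", OF _ h]
      by (simp add: D_def)
  qed
  let ?I = "{..<r} \<rightarrow>\<^sub>E ?K"
  define v where "v g i = (\<Prod>q<r. D (g q) i)" for g i
  have "det (block k H i j) ^ r = (\<Sum>g\<in>?I. cnj (v g i) * v g j)" if "i < n" "j < n" for i j
  proof -
    have "det (block k H i j) ^ r = (\<Prod>q<r. \<Sum>S\<in>?K. cnj (D S i) * D S j)"
      by (simp add: block that)
    also have "\<dots> = (\<Sum>g\<in>?I. \<Prod>q<r. cnj (D (g q) i) * D (g q) j)"
      using finK by (intro prod_sum_PiE) auto
    finally show ?thesis by (simp add: v_def prod.distrib)
  qed
  then have G: "mat n n (\<lambda>(i, j). det (block k H i j) ^ r)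
      = mat n n (\<lambda>(i, j). \<Sum>g\<in>?I. cnj (v g i) * v g j)"
    by (intro cong_mat) auto
  \<comment> \<open>Of all rows of \<open>v\<close>, only the constant tuples of block intervals are kept.\<close>
  define S where "S l = {l * k..<l * k + k}" for l
  define s where "s l = (\<lambda>q\<in>{..<r}. S l)" for l
  \<comment> \<open>The last element of the interval is \<open>l * k + (k - 1)\<close>, which lies
    below \<open>n * k\<close>.\<close>
  have SK: "S l \<in> ?K" if "l < n" for l
    using le[OF that, of "k - 1"] assms(2) by (auto simp: S_def)
  have hS: "h (S l) p = l * k + p" if "p < k" for l p
    using that by (simp add: h_def S_def)
  \<comment> \<open>The tuple has an entry as \<open>r \<ge> 1\<close>, and the interval is nonempty
    as \<open>k \<ge> 1\<close>, so its start determines \<open>l\<close>.\<close>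
  have "s l = s l' \<Longrightarrow> l = l'" for l l'
  proof -
    assume "s l = s l'"
    then have "s l 0 = s l' 0" by simp
    then have "S l = S l'" using assms(5) by (simp add: s_def)
    then show "l = l'" using assms(2) by (simp add: S_def atLeastLessThan_eq_iff)
  qed
  then have "inj_on s {0..<n}" by (auto simp: inj_on_def)
  moreover have "s ` {0..<n} \<subseteq> ?I" using SK by (fastforce simp: s_def)
  moreover have "finite ?I" using finK by (intro finite_PiE) auto
  ultimately have ge: "cnj (det (mat n n (\<lambda>(l, i). v (s l) i))) * det (mat n n (\<lambda>(l, i). v (s l) i))
      \<le> det (mat n n (\<lambda>(i, j). det (block k H i j) ^ r))"
    unfolding G by (intro det_gram_ge)
  have DS: "D (S l) i = det (mat k k (\<lambda>(p, a). T (l * k + p) (i * k + a)))" for l i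
    unfolding D_def by (intro arg_cong[where f = det] cong_mat) (auto simp: hS)
  \<comment> \<open>Blocks of \<open>T\<close> above the diagonal vanish, and a zero block of size
    \<open>k \<ge> 1\<close> has determinant 0.\<close>
  have D0: "D (S l) i = 0" if "l < i" for l i
  proof -
    have "T (l * k + p) (i * k + a) = 0" if "p < k" for p a
    proof (rule low)
      have "l * k + p < Suc l * k" using that by simp
      also have "\<dots> \<le> i * k" using \<open>l < i\<close> by (intro mult_le_mono1) simp
      finally show "l * k + p < i * k + a" by simp
    qed
    then have "mat k k (\<lambda>(p, a). T (l * k + p) (i * k + a)) = 0\<^sub>m k k"
      by (intro eq_matI) auto
    then show ?thesis using assms(2) by (simp add: DS)
  qed
  have Dii: "D (S i) i = (\<Prod>a<k. T (i * k + a) (i * k + a))" for i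
    unfolding DS by (rule det_lower) (simp add: low)
  let ?t = "\<Prod>l<?m. T l l"
  \<comment> \<open>On a constant tuple \<open>v\<close> is an \<open>r\<close>-th power, which
    vanishes above the diagonal because \<open>r \<ge> 1\<close>.\<close>
  have "det (mat n n (\<lambda>(l, i). v (s l) i)) = (\<Prod>i<n. D (S i) i ^ r)"
    by (subst det_lower) (use D0 assms(5) in \<open>auto simp: v_def s_def\<close>)
  also have "\<dots> = (\<Prod>i<n. \<Prod>l\<in>{i * k..<i * k + k}. T l l) ^ r"
    using prod.shift_bounds_nat_ivl[of "\<lambda>l. T l l" 0 _ k]
    by (simp add: Dii prod_power_distrib lessThan_atLeast0 prod.atLeastLessThan_shift_0[of _ "_ * k"])
  also have "\<dots> = ?t ^ r"
    by (simp add: prod.nat_group)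
  finally have v: "det (mat n n (\<lambda>(l, i). v (s l) i)) = ?t ^ r" .
  have "H = mat ?m ?m (\<lambda>(i, j). \<Sum>l<?m. cnj (T l i) * T l j)"
    using assms(3) by (intro eq_matI) (auto simp: HT)
  also have "\<dots> = mat ?m ?m (\<lambda>(i, j). cnj (T j i)) * mat ?m ?m (\<lambda>(i, j). T i j)"
    by (intro eq_matI) (auto simp: scalar_prod_def lessThan_atLeast0)
  \<comment> \<open>Separating transposition from conjugation reduces both factors to the
    determinant of \<open>T\<close>.\<close>
  also have "mat ?m ?m (\<lambda>(i, j). cnj (T j i)) = transpose_mat (mat ?m ?m (\<lambda>(i, j). cnj (T i j)))"
    by (intro eq_matI) auto
  finally have "det H = cnj ?t * ?t"
    by (simp add: det_mult[of _ ?m] det_transpose[of _ ?m] det_cnj det_lower low)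
  then show ?thesis using ge by (simp add: v power_mult_distrib)
qed

end
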